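(* Let $\imath:\mathcal{P}_+(G)\to\mathcal{M}_+(G)$, $\imath(\rho)=\rho$, be the natural inclusion. Then $\imath$ induces the Riemannian metric $g_W$ on $\mathcal{P}_+(G)$ via pullback of $g_{\mathcal{M}}$: for every $\rho\in\mathcal{P}_+(G)$ and all $\sigma_1,\sigma_2\in T_\rho\mathcal{P}_+(G)$, $$g_W(\sigma_1,\sigma_2)=g_{\mathcal{M}}(\sigma_1,\sigma_2).$$
   Context: $G=(V,E,\omega)$ is a connected, weighted, undirected finite graph with vertex set $V=\{1,\dots,n\}$, edge set $E$ and weights $\omega_{ij}=\omega_{ji}>0$ if $(i,j)\in E$, $\omega_{ij}=0$ otherwise; $N(i)=\{j:(i,j)\in E\}$. For $a\in\mathbb{R}^n$ put $\theta_{ij}(a)=\frac{a_i+a_j}{2}$; the linear weighted Laplacian matrix $L(a)\in\mathbb{R}^{n\times n}$ is the symmetric matrix given by $(L(a)\Phi)(i)=\sum_{j\in N(i)}\omega_{ij}\theta_{ij}(a)(\Phi(i)-\Phi(j))$ for $\Phi\in\mathbb{R}^n$. $A^\dagger$ denotes the Moore-Penrose pseudo-inverse, and $u_0=\frac{1}{\sqrt n}(1,\dots,1)^{\mathsf T}$. $\mathcal{P}_+(G)=\{\rho\in\mathbb{R}^n:\sum_i\rho_i=1,\ \rho_i>0\}$, with tangent space $T_\rho\mathcal{P}_+(G)=\{\sigma\in\mathbb{R}^n:\sum_i\sigma_i=0\}$, carries the ($L^2$-Wasserstein) inner product $g_W(\sigma_1,\sigma_2)=\sigma_1^{\mathsf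 T}L(\rho)^\dagger\sigma_2$. $\mathcal{M}_+(G)=\{\mu\in\mathbb{R}^n:\mu_i>0\}$, with tangent space $T_\mu\mathcal{M}_+(G)=\mathbb{R}^n$, carries the inner product $g_{\mathcal{M}}(a_1,a_2)=a_1^{\mathsf T}g(\mu)a_2$, where $g(\mu)=L(\mu)^\dagger+u_0u_0^{\mathsf T}$. *)

theory Defs
  imports "HOL-Analysis.Analysis"
begin

text \<open>
  The vertex set is the universe of a finite type, so its cardinality plays the role of
  the number of vertices. Loops are not excluded; they do not contribute to the Laplacian.
\<close>

locale connected_weighted_graph =
  fixes E :: "('n::finite \<times> 'n) set"
    and \<omega> :: "'n \<Rightarrow> 'n \<Rightarrow> real"
  assumes undirected: "sym E"
    and connected: "\<And>i j. (i, j) \<in> E\<^sup>*"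
    and weight_sym: "\<And>i j. \<omega> i j = \<omega> j i"
    and weight_pos: "\<And>i j. (i, j) \<in> E \<Longrightarrow> \<omega> i j > 0"
    and weight_zero: "\<And>i j. (i, j) \<notin> E \<Longrightarrow> \<omega> i j = 0"

definition nbh :: "('n \<times> 'n) set \<Rightarrow> 'n \<Rightarrow> 'n set" where
  "nbh E i = {j. (i, j) \<in> E}"

definition edge_mean :: "real ^ 'n \<Rightarrow> 'n \<Rightarrow> 'n \<Rightarrow> real" where
  "edge_mean a i j = (a $ i + a $ j) / 2"

definition laplacian_map ::
  "('n::finite \<times> 'n) set \<Rightarrow> ('n \<Rightarrow> 'n \<Rightarrow> real) \<Rightarrow> real ^ 'n \<Rightarrow> real ^ 'n \<Rightarrow> real ^ 'n" where
  "laplacian_map E \<omega> a \<Phi> =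
     (\<chi> i. \<Sum>j\<in>nbh E i. \<omega> i j * edge_mean a i j * (\<Phi> $ i - \<Phi> $ j))"

definition laplacian ::
  "('n::finite \<times> 'n) set \<Rightarrow> ('n \<Rightarrow> 'n \<Rightarrow> real) \<Rightarrow> real ^ 'n \<Rightarrow> real ^ 'n ^ 'n" where
  "laplacian E \<omega> a = matrix (laplacian_map E \<omega> a)"

lemma laplacian_mult_vec: "laplacian E \<omega> a *v \<Phi> = laplacian_map E \<omega> a \<Phi>"
proof -
  have "linear (laplacian_map E \<omega> a)"
    by (rule linearI)
       (auto simp: laplacian_map_def vec_eq_iff sum.distrib [symmetric] sum_distrib_left
             algebra_simps intro!: sum.cong)
  then show ?thesis
    by (simp add: laplacian_def matrix_works)
qed

definition is_moore_penrose :: "real ^ 'n::finite ^ 'm::finite \<Rightarrow> real ^ 'm ^ 'n \<Rightarrow> bool" where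
  "is_moore_penrose A X \<longleftrightarrow>
     A ** X ** A = A \<and> X ** A ** X = X \<and>
     transpose (A ** X) = A ** X \<and> transpose (X ** A) = X ** A"

definition pinv :: "real ^ 'n::finite ^ 'm::finite \<Rightarrow> real ^ 'm ^ 'n" where
  "pinv A = (THE X. is_moore_penrose A X)"

lemma is_moore_penrose_unique:
  assumes "is_moore_penrose A X" "is_moore_penrose A Y"
  shows "X = Y"
proof -
  have AX: "A ** X = A ** Y"
  proof -
    have "A ** X = transpose (A ** Y ** A ** X)"
      using assms by (simp add: is_moore_penrose_def)
    also have "\<dots> = transpose (A ** X) ** transpose (A ** Y)"
      by (simp add: matrix_transpose_mul matrix_mul_assoc)
    also have "\<dots> = A ** Y"
      using assms by (simp add: is_moore_penrose_def matrix_mul_assoc)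
    finally show ?thesis .
  qed
  have XA: "X ** A = Y ** A"
  proof -
    have "X ** A = transpose (X ** (A ** Y ** A))"
      using assms by (simp add: is_moore_penrose_def)
    also have "\<dots> = transpose (Y ** A) ** transpose (X ** A)"
      by (simp add: matrix_transpose_mul matrix_mul_assoc)
    also have "\<dots> = (Y ** A) ** (X ** A)"
      using assms by (simp add: is_moore_penrose_def)
    also have "\<dots> = Y ** (A ** X ** A)"
      by (simp add: matrix_mul_assoc)
    also have "\<dots> = Y ** A"
      using assms by (simp add: is_moore_penrose_def)
    finally show ?thesis .
  qed
  have "X = X ** A ** X" using assms by (simp add: is_moore_penrose_def)
  also have "\<dots> = Y ** (A ** X)" by (simp add: XA matrix_mul_assoc)
  also have "\<dots> = Y" using assms by (simp add: AX is_moore_penrose_def matrix_mul_assoc)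
  finally show ?thesis .
qed

lemma is_moore_penrose_exists:
  fixes A :: "real ^ 'n::finite ^ 'm::finite"
  shows "\<exists>X. is_moore_penrose A X"
proof -
  let ?T = "transpose A"
  note [simp del] = transpose_matrix_vector
  have adj: "(A *v x) \<bullet> y = x \<bullet> (?T *v y)" for x y
    by (metis dot_lmul_matrix inner_commute transpose_matrix_vector)
  have ker: "A *v x = 0" if "?T *v (A *v x) = 0" for x
    using adj [of x "A *v x"] that by simp
  have ex: "\<exists>r. (\<exists>w. r = ?T *v w) \<and> ?T *v (A *v r) = ?T *v y" for y
  proof -
    have "subspace (range ((*v) A))" "subspace (range ((*v) ?T))"
      by (rule linear_subspace_image [OF matrix_vector_mul_linear subspace_UNIV])+
    then have span: "span (range ((*v) A)) = range ((*v) A)"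
      "span (range ((*v) ?T)) = range ((*v) ?T)"
      by simp_all
    obtain p q where p: "p \<in> range ((*v) A)" "y = p + q"
      and q: "\<And>z. z \<in> range ((*v) A) \<Longrightarrow> orthogonal q z"
      using orthogonal_subspace_decomp_exists [of "range ((*v) A)" y] span by metis
    then obtain x where x: "p = A *v x" by blast
    obtain r s where r: "r \<in> range ((*v) ?T)" "x = r + s"
      and s: "\<And>z. z \<in> range ((*v) ?T) \<Longrightarrow> orthogonal s z"
      using orthogonal_subspace_decomp_exists [of "range ((*v) ?T)" x] span by metis
    have "?T *v q = 0"
      using q [of "A *v (?T *v q)"] adj [of "?T *v q" q]
      by (simp add: orthogonal_def inner_commute)
    moreover have "A *v s = 0"
      using s [of "?T *v (A *v s)"] adj [of s "A *v s"] by (simp add: orthogonal_def)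
    ultimately show ?thesis
      using p r x by (auto simp: matrix_vector_right_distrib intro!: exI [of _ r])
  qed
  then obtain R where R1: "\<And>y. \<exists>w. R y = ?T *v w" and R2: "\<And>y. ?T *v (A *v R y) = ?T *v y"
    by metis
  have uniq: "R y = r" if "r = ?T *v w" "?T *v (A *v r) = ?T *v y" for y r w
  proof -
    obtain v where v: "R y = ?T *v v" using R1 by blast
    have "A *v (R y - r) = 0"
      by (rule ker) (simp add: matrix_vector_mult_diff_distrib R2 that(2))
    moreover have "R y - r = ?T *v (v - w)"
      using v that by (simp add: matrix_vector_mult_diff_distrib)
    ultimately have "(R y - r) \<bullet> (R y - r) = 0"
      using adj [of "R y - r" "v - w"] by simp
    then show ?thesis by simp
  qed
  have lin: "linear R"
  proof (rule linearI)
    fix y z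
    obtain v w where vw: "R y = ?T *v v" "R z = ?T *v w" using R1 by meson
    show "R (y + z) = R y + R z"
    proof (rule uniq)
      show "R y + R z = ?T *v (v + w)"
        by (simp add: vw matrix_vector_right_distrib)
      show "?T *v (A *v (R y + R z)) = ?T *v (y + z)"
        by (simp add: R2 matrix_vector_right_distrib)
    qed
  next
    fix c y
    obtain v where v: "R y = ?T *v v" using R1 by meson
    show "R (c *\<^sub>R y) = c *\<^sub>R R y"
    proof (rule uniq)
      show "c *\<^sub>R R y = ?T *v (c *\<^sub>R v)"
        by (simp add: v matrix_vector_mult_scaleR)
      show "?T *v (A *v (c *\<^sub>R R y)) = ?T *v (c *\<^sub>R y)"
        by (simp add: R2 matrix_vector_mult_scaleR)
    qed
  qed
  define X where "X = matrix R"
  have X: "X *v y = R y" for y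
    using lin by (simp add: X_def matrix_works)
  have ARA: "A *v R (A *v z) = A *v z" for z
    using ker [of "R (A *v z) - z"] R2 [of "A *v z"]
    by (simp add: matrix_vector_mult_diff_distrib)
  have RAR: "R (A *v R y) = R y" for y
    using R1 [of y] R2 uniq by metis
  have sym1: "(A *v R y) \<bullet> z = (A *v R y) \<bullet> (A *v R z)" for y z
    by (simp add: adj R2)
  have sym2: "R (A *v y) \<bullet> z = R (A *v y) \<bullet> R (A *v z)" for y z
  proof -
    obtain w where "R (A *v y) = ?T *v w" using R1 by meson
    then show ?thesis
      using adj [of z w] adj [of "R (A *v z)" w] ARA [of z] by (simp add: inner_commute)
  qed
  have symI: "transpose B = B" if "\<And>y z. (B *v y) \<bullet> z = y \<bullet> (B *v z)"
    for B :: "real ^ 'k::finite ^ 'k"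
  proof -
    have "y \<bullet> (transpose B *v z) = y \<bullet> (B *v z)" for y z
      using that [of y z]
      by (metis dot_lmul_matrix inner_commute transpose_matrix_vector)
    then have "transpose B *v z = B *v z" for z
      using vector_eq_ldot by blast
    then show ?thesis by (simp add: matrix_eq)
  qed
  have "is_moore_penrose A X"
    unfolding is_moore_penrose_def
  proof (intro conjI symI)
    show "A ** X ** A = A" "X ** A ** X = X"
      by (simp_all add: matrix_eq X ARA RAR flip: matrix_vector_mul_assoc)
    show "((A ** X) *v y) \<bullet> z = y \<bullet> ((A ** X) *v z)" for y z
      using sym1 [of y z] sym1 [of z y]
      by (simp add: X inner_commute flip: matrix_vector_mul_assoc)
    show "((X ** A) *v y) \<bullet> z = y \<bullet> ((X ** A) *v z)" for y z
      using sym2 [of y z] sym2 [of z y]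
      by (simp add: X inner_commute flip: matrix_vector_mul_assoc)
  qed
  then show ?thesis ..
qed

lemma is_moore_penrose_pinv: "is_moore_penrose A (pinv A)"
  unfolding pinv_def
  by (rule theI') (use is_moore_penrose_exists is_moore_penrose_unique in blast)

definition u0 :: "real ^ 'n::finite" where
  "u0 = (1 / sqrt (real CARD('n))) *\<^sub>R (\<chi> i. 1)"

definition outer :: "real ^ 'm \<Rightarrow> real ^ 'n \<Rightarrow> real ^ 'n ^ 'm" where
  "outer u v = (\<chi> i j. u $ i * v $ j)"

definition prob_simplex :: "(real ^ 'n::finite) set" where
  "prob_simplex = {\<rho>. (\<Sum>i\<in>UNIV. \<rho> $ i) = 1 \<and> (\<forall>i. \<rho> $ i > 0)}"

definition tangent_prob :: "real ^ 'n::finite \<Rightarrow> (real ^ 'n) set" where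
  "tangent_prob \<rho> = {\<sigma>. (\<Sum>i\<in>UNIV. \<sigma> $ i) = 0}"

definition pos_measures :: "(real ^ 'n) set" where
  "pos_measures = {\<mu>. \<forall>i. \<mu> $ i > 0}"

definition g_W :: "('n::finite \<times> 'n) set \<Rightarrow> ('n \<Rightarrow> 'n \<Rightarrow> real) \<Rightarrow>
    real ^ 'n \<Rightarrow> real ^ 'n \<Rightarrow> real ^ 'n \<Rightarrow> real" where
  "g_W E \<omega> \<rho> \<sigma>1 \<sigma>2 = \<sigma>1 \<bullet> (pinv (laplacian E \<omega> \<rho>) *v \<sigma>2)"

definition metric_matrix ::
  "('n::finite \<times> 'n) set \<Rightarrow> ('n \<Rightarrow> 'n \<Rightarrow> real) \<Rightarrow> real ^ 'n \<Rightarrow> real ^ 'n ^ 'n" where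
  "metric_matrix E \<omega> \<mu> = pinv (laplacian E \<omega> \<mu>) + outer u0 u0"

text \<open>The tangent space of \<^const>\<open>pos_measures\<close> at every point is the whole space.\<close>

definition g_M :: "('n::finite \<times> 'n) set \<Rightarrow> ('n \<Rightarrow> 'n \<Rightarrow> real) \<Rightarrow>
    real ^ 'n \<Rightarrow> real ^ 'n \<Rightarrow> real ^ 'n \<Rightarrow> real" where
  "g_M E \<omega> \<mu> a1 a2 = a1 \<bullet> (metric_matrix E \<omega> \<mu> *v a2)"

definition incl :: "real ^ 'n \<Rightarrow> real ^ 'n" where
  "incl \<rho> = \<rho>"

text \<open>
  The differential of a map at a point, applied to a tangent vector, is the velocity of the
  image of a curve with that initial velocity. For the relatively open subset
  \<^const>\<open>prob_simplex\<close> of an affine hyperplane, the straight line through the point is such a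
  curve: it stays in the simplex for small times when the direction is tangent.
\<close>

definition differential ::
  "('a::real_normed_vector \<Rightarrow> 'b::real_normed_vector) \<Rightarrow> 'a \<Rightarrow> 'a \<Rightarrow> 'b" where
  "differential f x v = vector_derivative (\<lambda>t. f (x + t *\<^sub>R v)) (at 0)"

definition pullback_metric ::
  "('a::real_normed_vector \<Rightarrow> 'b::real_normed_vector) \<Rightarrow> ('b \<Rightarrow> 'b \<Rightarrow> 'b \<Rightarrow> real) \<Rightarrow>
     'a \<Rightarrow> 'a \<Rightarrow> 'a \<Rightarrow> real" where
  "pullback_metric f h x v w = h (f x) (differential f x v) (differential f x w)"

end

theory Submission
  imports Defs
begin

text \<open>
  The Laplacian kills constant vectors, and so does its pseudo-inverse; the summand
  \<open>u\<^sub>0 u\<^sub>0\<^sup>T\<close> of the metric matrix makes up for this in that one direction. The tangent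
  vectors of the simplex are exactly the vectors orthogonal to it
  (\<open>inner_u0_tangent_prob\<close>), so on them the summand vanishes and only the pseudo-inverse is
  left. The inclusion is linear, hence its differential is again the inclusion
  (\<open>differential_incl\<close>), and pulling back amounts to restricting to such vectors.
\<close>

lemma outer_mult_vec:
  fixes x :: "real ^ 'n::finite"
  shows "outer u v *v x = (v \<bullet> x) *\<^sub>R u"
  by (simp add: vec_eq_iff matrix_vector_mult_def outer_def inner_vec_def
      sum_distrib_left mult_ac)

lemma inner_u0_tangent_prob:
  assumes "\<sigma> \<in> tangent_prob \<rho>"
  shows "u0 \<bullet> \<sigma> = 0"
  using assms by (simp add: u0_def tangent_prob_def inner_vec_def flip: sum_divide_distrib)

lemma differential_incl: "differential incl \<rho> \<sigma> = \<sigma>"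
proof -
  have "((\<lambda>t. incl (\<rho> + t *\<^sub>R \<sigma>)) has_vector_derivative \<sigma>) (at 0)"
    unfolding incl_def by (auto intro!: derivative_eq_intros)
  then show ?thesis
    unfolding differential_def by (rule vector_derivative_at)
qed

theorem theorem1:
  fixes E :: "('n::finite \<times> 'n) set"
    and \<omega> :: "'n \<Rightarrow> 'n \<Rightarrow> real"
  assumes "connected_weighted_graph E \<omega>"
  shows "(incl :: real ^ 'n \<Rightarrow> real ^ 'n) ` prob_simplex \<subseteq> pos_measures \<and>
    (\<forall>\<rho>\<in>prob_simplex. \<forall>\<sigma>1\<in>tangent_prob \<rho>. \<forall>\<sigma>2\<in>tangent_prob \<rho>.
       g_W E \<omega> \<rho> \<sigma>1 \<sigma>2 = pullback_metric incl (g_M E \<omega>) \<rho> \<sigma>1 \<sigma>2 \<and>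
       g_W E \<omega> \<rho> \<sigma>1 \<sigma>2 = g_M E \<omega> \<rho> \<sigma>1 \<sigma>2)"
proof (intro conjI ballI)
  show "(incl :: real ^ 'n \<Rightarrow> real ^ 'n) ` prob_simplex \<subseteq> pos_measures"
    by (auto simp: incl_def prob_simplex_def pos_measures_def)
next
  fix \<rho> \<sigma>1 \<sigma>2 :: "real ^ 'n"
  assume "\<sigma>2 \<in> tangent_prob \<rho>"
  then show metrics_agree: "g_W E \<omega> \<rho> \<sigma>1 \<sigma>2 = g_M E \<omega> \<rho> \<sigma>1 \<sigma>2"
    by (simp add: g_W_def g_M_def metric_matrix_def matrix_vector_mult_add_rdistrib
        outer_mult_vec inner_u0_tangent_prob)
  then show "g_W E \<omega> \<rho> \<sigma>1 \<sigma>2 = pullback_metric incl (g_M E \<omega>) \<rho> \<sigma>1 \<sigma>2"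
    by (simp add: pullback_metric_def differential_incl incl_def)
qed

end
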